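(* Let $n \ge 1$ and $U \subseteq \mathbb{Z}_3^n$. If $U$ is disjoint from some maximum size independent set of $H(n,3)$ and the subgraph of $H(n,3)$ induced by $U$ has maximum degree at most $1$, then $|U| \le 3^{n-1}+1$.
   Context: $H(n,3)$ is the Hamming graph: its vertex set is $\mathbb{Z}_3^n$ and two vertices are adjacent if and only if they differ in exactly one coordinate. A maximum size independent set of $H(n,3)$ is an independent set of largest possible cardinality. *)

theory Defs
  imports "HOL-Library.FuncSet" "HOL-Library.Numeral_Type"
begin

text \<open>
  A graph is a pair of a vertex set and a set of edges, each edge being a two-element set
  of vertices.
\<close>

type_synonym 'a graph = "'a set \<times> 'a set set"

abbreviation verts :: "'a graph \<Rightarrow> 'a set" where
  "verts G \<equiv> fst G"

abbreviation edges :: "'a graph \<Rightarrow> 'a set set" where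
  "edges G \<equiv> snd G"

definition adjacent :: "'a graph \<Rightarrow> 'a \<Rightarrow> 'a \<Rightarrow> bool" where
  "adjacent G x y \<longleftrightarrow> {x, y} \<in> edges G"

definition induced_subgraph :: "'a graph \<Rightarrow> 'a set \<Rightarrow> 'a graph" where
  "induced_subgraph G U = (U, {e \<in> edges G. e \<subseteq> U})"

definition degree :: "'a graph \<Rightarrow> 'a \<Rightarrow> nat" where
  "degree G v = card {w \<in> verts G. adjacent G v w}"

text \<open>Inserting 0 only matters for the graph without vertices, whose maximum degree is 0.\<close>

definition max_degree :: "'a graph \<Rightarrow> nat" where
  "max_degree G = Max (insert 0 (degree G ` verts G))"

definition independent_set :: "'a graph \<Rightarrow> 'a set \<Rightarrow> bool" where
  "independent_set G S \<longleftrightarrow> S \<subseteq> verts G \<and> (\<forall>x\<in>S. \<forall>y\<in>S. \<not> adjacent G x y)"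

definition maximum_independent_set :: "'a graph \<Rightarrow> 'a set \<Rightarrow> bool" where
  "maximum_independent_set G S \<longleftrightarrow>
     independent_set G S \<and> (\<forall>T. independent_set G T \<longrightarrow> card T \<le> card S)"

text \<open>
  The type \<open>3\<close> is the ring of integers modulo 3.  An element of its \<open>n\<close>-th power is a function
  on \<open>{..<n}\<close>, fixed to be \<^const>\<open>undefined\<close> elsewhere so that distinct functions are
  distinct vectors.
\<close>

definition Z3_power :: "nat \<Rightarrow> (nat \<Rightarrow> 3) set" where
  "Z3_power n = ({..<n} \<rightarrow>\<^sub>E UNIV)"

definition hamming_graph :: "nat \<Rightarrow> (nat \<Rightarrow> 3) graph" where
  "hamming_graph n =
     (Z3_power n,
      {{x, y} | x y. x \<in> Z3_power n \<and> y \<in> Z3_power n \<and> card {i. i < n \<and> x i \<noteq> y i} = 1})"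

lemma verts_hamming_graph [simp]: "verts (hamming_graph n) = Z3_power n"
  by (simp add: hamming_graph_def)

lemma finite_Z3_power: "finite (Z3_power n)"
  unfolding Z3_power_def by (intro finite_PiE) auto

lemma card_Z3_power: "card (Z3_power n) = 3 ^ n"
  unfolding Z3_power_def by (simp add: card_PiE)

lemma adjacent_hamming_graph_iff:
  "adjacent (hamming_graph n) x y \<longleftrightarrow>
     x \<in> Z3_power n \<and> y \<in> Z3_power n \<and> (\<exists>!i. i < n \<and> x i \<noteq> y i)"
proof -
  define P where "P u v \<longleftrightarrow> card {i. i < n \<and> u i \<noteq> v i} = 1" for u v :: "nat \<Rightarrow> 3"
  have sym: "P u v \<Longrightarrow> P v u" for u v
    unfolding P_def by (simp only: eq_commute)
  have "adjacent (hamming_graph n) x y \<longleftrightarrow>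
      (\<exists>u v. {x, y} = {u, v} \<and> u \<in> Z3_power n \<and> v \<in> Z3_power n \<and> P u v)"
    unfolding adjacent_def hamming_graph_def snd_conv mem_Collect_eq P_def ..
  also have "\<dots> \<longleftrightarrow> x \<in> Z3_power n \<and> y \<in> Z3_power n \<and> P x y"
    unfolding doubleton_eq_iff using sym by blast
  also have "P x y \<longleftrightarrow> (\<exists>!i. i < n \<and> x i \<noteq> y i)"
  proof -
    have "(\<exists>i. {i. Q i} = {i}) \<longleftrightarrow> (\<exists>!i. Q i)" for Q :: "nat \<Rightarrow> bool"
      unfolding Ex1_def set_eq_iff mem_Collect_eq singleton_iff by blast
    then show ?thesis
      unfolding P_def One_nat_def card_1_singleton_iff .
  qed
  finally show ?thesis .
qed

lemma card_edge_hamming_graph: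
  assumes "e \<in> edges (hamming_graph n)"
  shows "e \<subseteq> verts (hamming_graph n)" "card e = 2"
proof -
  obtain x y where e: "e = {x, y}" "x \<in> Z3_power n" "y \<in> Z3_power n"
    and d: "card {i. i < n \<and> x i \<noteq> y i} = 1"
    using assms unfolding hamming_graph_def snd_conv by blast
  have "x \<noteq> y"
    using d by force
  with e show "e \<subseteq> verts (hamming_graph n)" "card e = 2"
    by simp_all
qed

end

theory Submission imports Defs begin

text \<open>
  A maximum independent set meets every line in exactly one point, so it is a level set of a
  map to \<open>\<int>\<^sub>3\<close> which, after changing the signs of some coordinates, increases by 1 along every
  unit step. The set \<open>U\<close> then lies in two consecutive levels \<open>A\<close> (level 0) and \<open>B\<close>
  (level 1), and its edges join \<open>x \<in> A\<close> to \<open>x + e\<^sub>i \<in> B\<close>.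

  Call the excess of a subcube of dimension \<open>m\<close> the number of points of \<open>U\<close> in it minus
  \<open>3 ^ (m - 1)\<close>; it is additive over the three slices in any direction. By induction on \<open>m\<close>,
  the excess is at most 1, and if it is 1 then \<open>U\<close> is perfectly matched inside the subcube.
  The matching prevents two slices in the same direction from both having excess 1: a point of
  \<open>A\<close> in one slice cannot have its upper neighbour in the other one, and counting gives a
  contradiction. That the matching exists comes from a full layer: for some direction \<open>j\<close> and
  value \<open>d\<close>, the set \<open>U\<close> contains all points of level 0 with \<open>x\<^sub>j = d\<close> and all points of
  level 1 with \<open>x\<^sub>j = d + 1\<close>; these are matched with each other, and the remaining slice again
  has excess 1.
\<close>

section \<open>Arithmetic modulo 3\<close>

lemma Z3_cases: "(a::3) = 0 \<or> a = 1 \<or> a = 2"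
proof (induct a)
  case (of_int z)
  then have "z = 0 \<or> z = 1 \<or> z = 2" by auto
  then show ?case by auto
qed

lemma UNIV_Z3: "(UNIV :: 3 set) = {a, a + 1, a + 2}"
proof -
  have "b \<in> {a, a + 1, a + 2}" for b
    using Z3_cases[of "b - a"] by (auto simp: algebra_simps)
  then show ?thesis by blast
qed

lemma Z3_distinct [simp]: "(a::3) + 1 \<noteq> a" "a + 2 \<noteq> a" "a + 1 \<noteq> a + 2" "a + 2 \<noteq> a + 1" "a \<noteq> a + 1" "a \<noteq> a + 2"
  by simp_all

lemma Z3_add [simp]: "(a::3) + 1 + 1 = a + 2" "a + 2 + 1 = a" "a + 1 + 2 = a" "a + 2 + 2 = a + 1"
    "a - 1 = a + 2" "a - 2 = a + 1"
  using Z3_cases[of a] by auto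

section \<open>Subcubes and unit steps\<close>

text \<open>\<open>J\<close> holds the free coordinates; the others are frozen at \<open>z\<close>.
  A slice is then again a subcube, with one coordinate removed from \<open>J\<close> and
  \<open>z\<close> updated there.\<close>

definition cube :: "'i set \<Rightarrow> ('i \<Rightarrow> 3) \<Rightarrow> ('i \<Rightarrow> 3) set" where
  "cube J z = {x. \<forall>i. i \<notin> J \<longrightarrow> x i = z i}"

definition up :: "'i \<Rightarrow> ('i \<Rightarrow> 3) \<Rightarrow> 'i \<Rightarrow> 3" where
  "up i x = x(i := x i + 1)"

definition dn :: "'i \<Rightarrow> ('i \<Rightarrow> 3) \<Rightarrow> 'i \<Rightarrow> 3" where
  "dn i x = x(i := x i + 2)"

lemma up_dn [simp]: "up i (dn i x) = x" "dn i (up i x) = x"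
  by (auto simp: up_def dn_def)

lemma up_apply: "up i x k = (if k = i then x k + 1 else x k)"
  by (simp add: up_def)

lemma dn_apply: "dn i x k = (if k = i then x k + 2 else x k)"
  by (simp add: dn_def)

lemma up_cube: "i \<in> J \<Longrightarrow> up i x \<in> cube J z \<longleftrightarrow> x \<in> cube J z"
  unfolding cube_def up_def by (auto split: if_splits)

lemma dn_cube: "i \<in> J \<Longrightarrow> dn i x \<in> cube J z \<longleftrightarrow> x \<in> cube J z"
  unfolding cube_def dn_def by (auto split: if_splits)

lemma slice_iff: "i \<in> J \<Longrightarrow> x \<in> cube (J - {i}) (z(i := a)) \<longleftrightarrow> x \<in> cube J z \<and> x i = a"
  unfolding cube_def by auto

lemma finite_cube:
  assumes "finite J"
  shows "finite (cube J z)"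
proof -
  have "cube J z \<subseteq> (\<lambda>f i. if i \<in> J then f i else z i) ` (J \<rightarrow>\<^sub>E UNIV)"
  proof
    fix x assume "x \<in> cube J z"
    then have "x = (\<lambda>i. if i \<in> J then restrict x J i else z i)"
      by (auto simp: cube_def)
    then show "x \<in> (\<lambda>f i. if i \<in> J then f i else z i) ` (J \<rightarrow>\<^sub>E UNIV)"
      by (rule image_eqI[where x = "restrict x J"]) auto
  qed
  moreover have "finite (J \<rightarrow>\<^sub>E (UNIV :: 3 set))"
    using assms by (intro finite_PiE) auto
  ultimately show ?thesis
    by (meson finite_imageI finite_subset)
qed

lemma card_cube_split:
  assumes "finite J" "i \<in> J"
  shows "card (X \<inter> cube J z) = card (X \<inter> cube (J - {i}) (z(i := a)))
    + card (X \<inter> cube (J - {i}) (z(i := a + 1))) + card (X \<inter> cube (J - {i}) (z(i := a + 2)))"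
proof -
  let ?S = "\<lambda>b. X \<inter> cube (J - {i}) (z(i := b))"
  have fin: "finite (?S b)" for b
    using assms finite_cube[of "J - {i}"] by auto
  have "X \<inter> cube J z = (\<Union>b\<in>UNIV. ?S b)"
    using assms by (auto simp: slice_iff)
  also have "\<dots> = (?S a \<union> ?S (a + 1)) \<union> ?S (a + 2)"
    unfolding UNIV_Z3[of a] by auto
  also have "card \<dots> = card (?S a \<union> ?S (a + 1)) + card (?S (a + 2))"
    using fin assms by (intro card_Un_disjoint) (auto simp: slice_iff)
  also have "card (?S a \<union> ?S (a + 1)) = card (?S a) + card (?S (a + 1))"
    using fin assms by (intro card_Un_disjoint) (auto simp: slice_iff)
  finally show ?thesis .
qed

section \<open>Level sets of a function that grows by 1 along unit steps\<close>

locale layered_cube =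
  fixes D :: "'i set" and cl :: "('i \<Rightarrow> 3) \<Rightarrow> 3"
  assumes finite_D: "finite D"
    and cl_up: "i \<in> D \<Longrightarrow> cl (up i x) = cl x + 1"
begin

lemma cl_dn: "i \<in> D \<Longrightarrow> cl (dn i x) = cl x + 2"
  using cl_up[of i "dn i x"] by (metis up_dn(1) Z3_add(3))

lemma cl_add:
  assumes "i \<in> D"
  shows "cl (x(i := x i + t)) = cl x + t"
  using Z3_cases[of t] cl_up[OF assms, of x] cl_dn[OF assms, of x]
  by (auto simp: up_def dn_def)

text \<open>Along a line in direction \<open>i\<close>, \<open>cl\<close> is a translate of
  coordinate \<open>i\<close>, hence injective.\<close>

lemma cube_determined:
  assumes "x \<in> cube {i} z" "y \<in> cube {i} z" "i \<in> D" "cl x = cl y"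
  shows "x = y"
proof -
  have "y = x(i := x i + (y i - x i))"
    using assms(1,2) by (auto simp: cube_def fun_eq_iff)
  then have "cl y = cl x + (y i - x i)"
    using cl_add[OF assms(3)] by metis
  then have "y i = x i" using assms(4) by simp
  then show ?thesis
    using assms(1,2) unfolding cube_def fun_eq_iff by auto metis
qed

text \<open>A line meets every level once, and each further direction triples the count.\<close>

lemma card_level:
  assumes "J \<subseteq> D" "J \<noteq> {}"
  shows "card ({x. cl x = s} \<inter> cube J z) = 3 ^ (card J - 1)"
proof -
  have "finite J" using assms finite_D finite_subset by blast
  then show ?thesis using assms(2,1)
  proof (induction J arbitrary: z rule: finite_ne_induct)
    case (singleton i)
    let ?x = "z(i := z i + (s - cl z))"
    have "cl ?x = s" "?x \<in> cube {i} z"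
      using singleton cl_add[of i z "s - cl z"] by (auto simp: cube_def)
    moreover have "y = ?x" if "cl y = s" "y \<in> cube {i} z" for y
      using that calculation cube_determined[of y i z ?x] singleton by simp
    ultimately have "{x. cl x = s} \<inter> cube {i} z = {?x}"
      by blast
    then show ?case by simp
  next
    case (insert i J)
    have "card ({x. cl x = s} \<inter> cube (insert i J) z) = 3 * 3 ^ (card J - 1)"
      using card_cube_split[of "insert i J" i "{x. cl x = s}" z 0] insert by simp
    moreover have "card J > 0" using insert by (simp add: card_gt_0_iff)
    ultimately show ?case using insert by (cases "card J") auto
  qed
qed

text \<open>One or two moves \<open>dn l \<circ> up k\<close>, with \<open>k\<close> and
  \<open>l\<close> both coordinates where the points differ, correct coordinate \<open>k\<close> and
  disturb no coordinate where they agree. So the Hamming distance drops.\<close>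

lemma moves_connect:
  assumes J: "J \<subseteq> D"
    and closed: "\<And>x k l. x \<in> P \<Longrightarrow> k \<in> J \<Longrightarrow> l \<in> J \<Longrightarrow> dn l (up k x) \<in> P"
    and "x \<in> P" "x \<in> cube J z" "y \<in> cube J z" "cl x = cl y"
  shows "y \<in> P"
  using assms(3-)
proof (induction "card {i\<in>J. x i \<noteq> y i}" arbitrary: x rule: less_induct)
  case less
  have fin: "finite J" using J finite_D finite_subset by blast
  show ?case
  proof (cases "x = y")
    case False
    then obtain k where k: "k \<in> J" "x k \<noteq> y k"
      using less.prems(2,3) unfolding cube_def by fastforce
    \<comment> \<open>If \<open>k\<close> were the only difference, both points would lie on one
      line, where the level determines the point.\<close>
    have "\<exists>l\<in>J. l \<noteq> k \<and> x l \<noteq> y l"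
    proof (rule ccontr)
      assume "\<not> ?thesis"
      then have "x \<in> cube {k} z'" "y \<in> cube {k} z'" if "z' = x" for z'
        using less.prems(2,3) that unfolding cube_def by auto
      then show False
        using cube_determined[of x k x y] k J less.prems(4) by auto
    qed
    then obtain l where l: "l \<in> J" "l \<noteq> k" "x l \<noteq> y l" by blast
    define x1 where "x1 = dn l (up k x)"
    define x2 where "x2 = dn l (up k x1)"
    have P: "x1 \<in> P" "x2 \<in> P"
      using closed k l less.prems(1) by (auto simp: x1_def x2_def)
    have cu: "x1 \<in> cube J z" "x2 \<in> cube J z"
      using less.prems(2) k l by (auto simp: x1_def x2_def up_cube dn_cube)
    have c: "cl x1 = cl y" "cl x2 = cl y"
      using less.prems(4) k l J by (auto simp: x1_def x2_def cl_up cl_dn subset_iff)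
    have other: "x1 m = x m" "x2 m = x m" if "m \<noteq> k" "m \<noteq> l" for m
      using that by (auto simp: x1_def x2_def up_apply dn_apply)
    have "x1 k = y k \<or> x2 k = y k"
      using k l Z3_cases[of "y k - x k"]
      by (auto simp: x1_def x2_def up_apply dn_apply algebra_simps)
    then obtain w where w: "w \<in> {x1, x2}" "w k = y k" by blast
    have "{i\<in>J. w i \<noteq> y i} \<subseteq> {i\<in>J. x i \<noteq> y i} - {k}"
      using w other l by (auto; metis)
    then have "card {i\<in>J. w i \<noteq> y i} < card {i\<in>J. x i \<noteq> y i}"
      using k fin by (intro psubset_card_mono) auto
    then show ?thesis
      using less.hyps[of w] w P cu c less.prems(3) by auto
  qed (use less in simp)
qed


lemma card_level_le:
  assumes "J \<subseteq> D" "J \<noteq> {}" "\<And>x. x \<in> X \<Longrightarrow> cl x = s"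
  shows "card (X \<inter> cube J z) \<le> 3 ^ (card J - 1)"
proof -
  have "finite J" using assms finite_D finite_subset by blast
  then have "card (X \<inter> cube J z) \<le> card ({x. cl x = s} \<inter> cube J z)"
    using assms(3) finite_cube[of J z] by (intro card_mono) auto
  then show ?thesis using card_level[OF assms(1,2)] by simp
qed

text \<open>Translates between counting and containment: a subset of a finite level that has the
  size of the level is the whole level.\<close>

lemma level_full_iff:
  assumes "J \<subseteq> D" "J \<noteq> {}" "\<And>x. x \<in> X \<Longrightarrow> cl x = s"
  shows "card (X \<inter> cube J z) = 3 ^ (card J - 1) \<longleftrightarrow> (\<forall>x\<in>cube J z. cl x = s \<longrightarrow> x \<in> X)"
proof -
  have "finite J" using assms finite_D finite_subset by blast
  then have "finite ({x. cl x = s} \<inter> cube J z)" using finite_cube by auto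
  moreover have sub: "X \<inter> cube J z \<subseteq> {x. cl x = s} \<inter> cube J z" using assms(3) by auto
  ultimately have "card (X \<inter> cube J z) = 3 ^ (card J - 1) \<longleftrightarrow>
      X \<inter> cube J z = {x. cl x = s} \<inter> cube J z"
    using card_subset_eq card_level[OF assms(1,2)] by metis
  also have "\<dots> \<longleftrightarrow> (\<forall>x\<in>cube J z. cl x = s \<longrightarrow> x \<in> X)"
    using sub by blast
  finally show ?thesis .
qed

end

section \<open>Two sparse levels: excess, matchings, full layers\<close>

text \<open>\<open>A\<close> and \<open>B\<close> stand for the two levels of \<open>U\<close>. A
  line meets each level once, so no edge stays inside a level, and maximum degree 1 becomes
  uniqueness of the direction leading to the other level.\<close>

locale sparse_layers = layered_cube D cl for D :: "'i set" and cl +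
  fixes A B :: "('i \<Rightarrow> 3) set"
  assumes cl_A: "x \<in> A \<Longrightarrow> cl x = 0"
    and cl_B: "y \<in> B \<Longrightarrow> cl y = 1"
    and up_unique: "\<lbrakk>x \<in> A; i \<in> D; j \<in> D; up i x \<in> B; up j x \<in> B\<rbrakk> \<Longrightarrow> i = j"
    and dn_unique: "\<lbrakk>y \<in> B; i \<in> D; j \<in> D; dn i y \<in> A; dn j y \<in> A\<rbrakk> \<Longrightarrow> i = j"
begin

text \<open>An integer, because negative values occur and enter the estimates. The truncated
  exponent is meant for nonempty \<open>J\<close>.\<close>

definition excess :: "'i set \<Rightarrow> ('i \<Rightarrow> 3) \<Rightarrow> int" where
  "excess J z = int (card (A \<inter> cube J z)) + int (card (B \<inter> cube J z)) - 3 ^ (card J - 1)"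

definition perfectly_matched :: "'i set \<Rightarrow> ('i \<Rightarrow> 3) \<Rightarrow> bool" where
  "perfectly_matched J z \<longleftrightarrow>
     (\<forall>x\<in>A \<inter> cube J z. \<exists>i\<in>J. up i x \<in> B) \<and> (\<forall>y\<in>B \<inter> cube J z. \<exists>i\<in>J. dn i y \<in> A) \<and>
     card (A \<inter> cube J z) = card (B \<inter> cube J z)"

text \<open>For \<open>j \<in> J\<close>, \<open>up j\<close> maps the first of the two required
  sets onto the second, so a full layer brings its own matching.\<close>

definition full_layer :: "'i set \<Rightarrow> ('i \<Rightarrow> 3) \<Rightarrow> 'i \<Rightarrow> 3 \<Rightarrow> bool" where
  "full_layer J z j d \<longleftrightarrow>
     (\<forall>x\<in>cube J z. cl x = 0 \<longrightarrow> x j = d \<longrightarrow> x \<in> A) \<and>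
     (\<forall>y\<in>cube J z. cl y = 1 \<longrightarrow> y j = d + 1 \<longrightarrow> y \<in> B)"

lemmas card_A_le = card_level_le[where X = A and s = 0, OF _ _ cl_A]
lemmas card_B_le = card_level_le[where X = B and s = 1, OF _ _ cl_B]
lemmas A_full_iff = level_full_iff[where X = A and s = 0, OF _ _ cl_A]
lemmas B_full_iff = level_full_iff[where X = B and s = 1, OF _ _ cl_B]

lemma excess_split:
  assumes "J \<subseteq> D" "i \<in> J" "J - {i} \<noteq> {}"
  shows "excess J z = excess (J - {i}) (z(i := a)) + excess (J - {i}) (z(i := a + 1))
    + excess (J - {i}) (z(i := a + 2))"
proof -
  have fin: "finite J" using assms finite_D finite_subset by blast
  then have "card J = Suc (card (J - {i}))"
    using card_Suc_Diff1[of J i] assms(2) by simp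
  moreover have "card (J - {i}) > 0"
    using fin assms(3) card_gt_0_iff by blast
  ultimately have "(3::int) ^ (card J - 1) = 3 * 3 ^ (card (J - {i}) - 1)"
    by (metis One_nat_def Suc_pred diff_Suc_1 power_Suc)
  then show ?thesis
    using card_cube_split[OF fin assms(2), of A z a] card_cube_split[OF fin assms(2), of B z a]
    unfolding excess_def by simp
qed

text \<open>\<open>up i\<close> carries the first set into level 1 of the slice
  \<open>a + 1\<close>, where it avoids \<open>B\<close>, so both sets fit into a single
  level.\<close>

lemma card_translate:
  assumes "J \<subseteq> D" "J \<noteq> {}" "i \<in> D" "i \<notin> J"
    and unmatched: "\<And>x. x \<in> A \<Longrightarrow> x \<in> cube J (z(i := a)) \<Longrightarrow> up i x \<notin> B"
  shows "card (A \<inter> cube J (z(i := a))) + card (B \<inter> cube J (z(i := a + 1))) \<le> 3 ^ (card J - 1)"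
proof -
  let ?A = "A \<inter> cube J (z(i := a))" and ?B = "B \<inter> cube J (z(i := a + 1))"
  have "finite J" using assms finite_D finite_subset by blast
  then have fin: "finite ?A" "finite ?B" using finite_cube by auto
  have "inj_on (up i) ?A" by (metis inj_onI up_dn(2))
  then have "card ?A + card ?B = card (up i ` ?A) + card ?B"
    by (simp add: card_image)
  also have "\<dots> = card (up i ` ?A \<union> ?B)"
    using fin unmatched by (intro card_Un_disjoint[symmetric]) auto
  also have "up i ` ?A \<union> ?B = (up i ` ?A \<union> ?B) \<inter> cube J (z(i := a + 1))"
    using assms(4) by (auto simp: cube_def up_def)
  also have "card \<dots> \<le> 3 ^ (card J - 1)"
    using assms cl_A cl_B by (intro card_level_le[where s = 1]) (auto simp: cl_up)
  finally show ?thesis .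
qed

text \<open>The partner of \<open>x\<close> inside the subcube already uses up its only
  edge.\<close>

lemma perfectly_matched_up:
  assumes "perfectly_matched J z" "J \<subseteq> D" "x \<in> A" "x \<in> cube J z" "i \<in> D" "i \<notin> J"
  shows "up i x \<notin> B"
  using assms up_unique unfolding perfectly_matched_def by blast

lemma card_perfectly_matched:
  assumes "perfectly_matched J z" "excess J z = 1"
  shows "2 * int (card (A \<inter> cube J z)) = 3 ^ (card J - 1) + 1"
    "2 * int (card (B \<inter> cube J z)) = 3 ^ (card J - 1) + 1"
  using assms unfolding perfectly_matched_def excess_def by auto

text \<open>Two distinct slices are cyclically consecutive. The lower one is matched internally, so
  by translation its \<open>A\<close> and the \<open>B\<close> of the upper one together have at
  most the size of a level; yet each exceeds half of that.\<close>

lemma no_two_excess_slices: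
  assumes J: "J \<subseteq> D" "i \<in> J" "J - {i} \<noteq> {}"
    and matched: "\<And>a. excess (J - {i}) (z(i := a)) = 1 \<Longrightarrow> perfectly_matched (J - {i}) (z(i := a))"
    and ex: "excess (J - {i}) (z(i := a)) = 1" "excess (J - {i}) (z(i := b)) = 1"
  shows "a = b"
proof -
  have *: False
    if "excess (J - {i}) (z(i := a)) = 1" "excess (J - {i}) (z(i := a + 1)) = 1" for a
  proof -
    let ?J = "J - {i}"
    have "card (A \<inter> cube ?J (z(i := a))) + card (B \<inter> cube ?J (z(i := a + 1))) \<le> 3 ^ (card ?J - 1)"
      using J perfectly_matched_up[OF matched[OF that(1)]] by (intro card_translate) auto
    then have "int (card (A \<inter> cube ?J (z(i := a)))) + int (card (B \<inter> cube ?J (z(i := a + 1))))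
        \<le> 3 ^ (card ?J - 1)"
      by (metis of_nat_add of_nat_le_iff of_nat_numeral of_nat_power)
    then show False
      using card_perfectly_matched[OF matched[OF that(1)] that(1)]
        card_perfectly_matched[OF matched[OF that(2)] that(2)] by linarith
  qed
  have "b = a \<or> b = a + 1 \<or> a = b + 1"
    using Z3_cases[of a] Z3_cases[of b] by auto
  then show ?thesis using * ex by metis
qed

lemma excess_singleton_le:
  assumes "i \<in> D"
  shows "excess {i} z \<le> 1"
  using card_A_le[of "{i}" z] card_B_le[of "{i}" z] assms unfolding excess_def by auto

lemma perfectly_matched_singleton:
  assumes "i \<in> D" "excess {i} z = 1"
  shows "perfectly_matched {i} z"
proof -
  have "card (A \<inter> cube {i} z) \<le> 1" "card (B \<inter> cube {i} z) \<le> 1"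
    using card_A_le[of "{i}" z] card_B_le[of "{i}" z] assms by auto
  then have c: "card (A \<inter> cube {i} z) = 1" "card (B \<inter> cube {i} z) = 1"
    using assms(2) unfolding excess_def by auto
  then obtain x y where xy: "A \<inter> cube {i} z = {x}" "B \<inter> cube {i} z = {y}"
    by (metis card_1_singletonE)
  then have mem: "x \<in> A" "x \<in> cube {i} z" "y \<in> B" "y \<in> cube {i} z" by auto
  have "up i x = y"
    using mem assms(1) cl_A[of x] cl_B[of y]
    by (intro cube_determined[of _ i z]) (auto simp: up_cube cl_up)
  then show ?thesis
    using mem c xy unfolding perfectly_matched_def by auto
qed

text \<open>The layer is matched along \<open>j\<close>. It keeps \<open>B\<close> out of slice
  \<open>d\<close> and \<open>A\<close> out of slice \<open>d + 1\<close>, so both have excess 0,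
  and the third slice has excess 1 and is matched by assumption.\<close>

lemma perfectly_matched_of_full_layer:
  assumes J: "J \<subseteq> D" "j \<in> J" "J - {j} \<noteq> {}"
    and full: "full_layer J z j d"
    and ex: "excess J z = 1"
    and matched: "\<And>a. excess (J - {j}) (z(j := a)) = 1 \<Longrightarrow> perfectly_matched (J - {j}) (z(j := a))"
  shows "perfectly_matched J z"
proof -
  let ?J = "J - {j}" and ?K = "3 ^ (card (J - {j}) - 1) :: nat"
  have mem: "x \<in> cube ?J (z(j := a)) \<longleftrightarrow> x \<in> cube J z \<and> x j = a" for x a
    using J by (simp add: slice_iff)
  have sub: "?J \<subseteq> D" using J by auto
  have fullA: "x \<in> A" if "x \<in> cube J z" "cl x = 0" "x j = d" for x
    using that full unfolding full_layer_def by auto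
  have fullB: "x \<in> B" if "x \<in> cube J z" "cl x = 1" "x j = d + 1" for x
    using that full unfolding full_layer_def by auto
  obtain k where k: "k \<in> J" "k \<noteq> j" using J by auto
  have D: "j \<in> D" "k \<in> D" using k J by auto
  have emptyB: "B \<inter> cube ?J (z(j := d)) = {}"
  proof (rule ccontr)
    assume "\<not> ?thesis"
    then obtain y where y: "y \<in> B" "y \<in> cube J z" "y j = d" using mem by blast
    \<comment> \<open>A point of the layer with two neighbours in \<open>B\<close>, namely
      \<open>y\<close> and \<open>up j ?x\<close>.\<close>
    let ?x = "dn k y"
    have "?x \<in> A" using y k D cl_B by (intro fullA) (auto simp: dn_cube cl_dn dn_apply)
    moreover have "up j ?x \<in> B"
      using y k J D cl_B[of y]
      by (intro fullB) (auto simp: dn_cube up_cube cl_dn cl_up dn_apply up_apply)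
    moreover have "up k ?x \<in> B" using y by simp
    ultimately show False using up_unique D k by blast
  qed
  have emptyA: "A \<inter> cube ?J (z(j := d + 1)) = {}"
  proof (rule ccontr)
    assume "\<not> ?thesis"
    then obtain x where x: "x \<in> A" "x \<in> cube J z" "x j = d + 1" using mem by blast
    let ?y = "up k x"
    have "?y \<in> B" using x k D cl_A by (intro fullB) (auto simp: up_cube cl_up up_apply)
    moreover have "dn j ?y \<in> A"
      using x k J D cl_A[of x]
      by (intro fullA) (auto simp: dn_cube up_cube cl_dn cl_up dn_apply up_apply)
    moreover have "dn k ?y \<in> A" using x by simp
    ultimately show False using dn_unique D k by blast
  qed
  have cA: "card (A \<inter> cube ?J (z(j := d))) = ?K"
    using A_full_iff[OF sub J(3)] fullA mem by blast
  have cB: "card (B \<inter> cube ?J (z(j := d + 1))) = ?K"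
    using B_full_iff[OF sub J(3)] fullB mem by blast
  have "excess ?J (z(j := d)) = 0" "excess ?J (z(j := d + 1)) = 0"
    using cA cB emptyA emptyB unfolding excess_def by auto
  then have "excess ?J (z(j := d + 2)) = 1"
    using excess_split[OF J, of z d] ex by simp
  then have m: "perfectly_matched ?J (z(j := d + 2))" by (rule matched)
  have "finite J" using J finite_D finite_subset by blast
  then have "card (A \<inter> cube J z) = card (B \<inter> cube J z)"
    using card_cube_split[of J j _ z d] J(2) cA cB emptyA emptyB m
    unfolding perfectly_matched_def by simp
  moreover have "\<exists>i\<in>J. up i x \<in> B" if x: "x \<in> A" "x \<in> cube J z" for x
  proof -
    consider "x j = d" | "x j = d + 1" | "x j = d + 2" using UNIV_Z3[of d] by blast
    then show ?thesis
    proof cases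
      case 1
      then have "up j x \<in> B"
        using x J D cl_A by (intro fullB) (auto simp: up_cube cl_up up_apply)
      then show ?thesis using J by blast
    next
      case 2 then show ?thesis using x emptyA mem by blast
    next
      case 3 then show ?thesis using x m mem unfolding perfectly_matched_def by blast
    qed
  qed
  moreover have "\<exists>i\<in>J. dn i y \<in> A" if y: "y \<in> B" "y \<in> cube J z" for y
  proof -
    consider "y j = d" | "y j = d + 1" | "y j = d + 2" using UNIV_Z3[of d] by blast
    then show ?thesis
    proof cases
      case 1 then show ?thesis using y emptyB mem by blast
    next
      case 2
      then have "dn j y \<in> A"
        using y J D cl_B by (intro fullA) (auto simp: dn_cube cl_dn dn_apply)
      then show ?thesis using J by blast
    next
      case 3 then show ?thesis using y m mem unfolding perfectly_matched_def by blast
    qed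
  qed
  ultimately show ?thesis unfolding perfectly_matched_def by blast
qed

text \<open>
  Every \<open>up k\<close> maps \<open>A\<close> onto the part of level 1 outside \<open>B\<close>, so \<open>A\<close> is closed under the moves
  \<open>dn l \<circ> up k\<close>, which connect each level.
\<close>

lemma independent_extremal:
  assumes J: "J \<subseteq> D" "J \<noteq> {}"
    and ex: "excess J z = 0"
    and indep: "\<And>x k. x \<in> A \<Longrightarrow> x \<in> cube J z \<Longrightarrow> k \<in> J \<Longrightarrow> up k x \<notin> B"
  obtains "\<And>x. x \<in> cube J z \<Longrightarrow> cl x = 0 \<Longrightarrow> x \<in> A" "B \<inter> cube J z = {}"
    | "A \<inter> cube J z = {}" "\<And>x. x \<in> cube J z \<Longrightarrow> cl x = 1 \<Longrightarrow> x \<in> B"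
proof -
  let ?A = "A \<inter> cube J z" and ?V = "{x. cl x = 1} \<inter> cube J z - B"
  have "finite J" using J finite_D finite_subset by blast
  then have fin: "finite (cube J z)" by (rule finite_cube)
  have "?V = {x. cl x = 1} \<inter> cube J z - B \<inter> cube J z" by blast
  also have "card \<dots> = card ({x. cl x = 1} \<inter> cube J z) - card (B \<inter> cube J z)"
    using fin cl_B by (intro card_Diff_subset) auto
  also have "\<dots> = 3 ^ (card J - 1) - card (B \<inter> cube J z)"
    using card_level J by simp
  also have "\<dots> = card ?A"
    using ex unfolding excess_def by (simp add: algebra_simps flip: of_nat_add)
  finally have cV: "card ?V = card ?A" .
  have onto: "up k ` ?A = ?V" if k: "k \<in> J" for k
  proof (rule card_subset_eq)
    show "finite ?V" using fin by auto
    show "up k ` ?A \<subseteq> ?V" using k indep J cl_A by (auto simp: up_cube cl_up)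
    have "inj_on (up k) ?A" by (metis inj_onI up_dn(2))
    then show "card (up k ` ?A) = card ?V" by (simp add: card_image cV)
  qed
  have closed: "dn l (up k x) \<in> ?A" if "x \<in> ?A" "k \<in> J" "l \<in> J" for x k l
  proof -
    have "up k x \<in> up l ` ?A" using onto that by blast
    then show ?thesis by auto
  qed
  show ?thesis
  proof (cases "?A = {}")
    case True
    then have "int (card (B \<inter> cube J z)) = int (3 ^ (card J - 1))"
      using ex unfolding excess_def by simp
    then have "card (B \<inter> cube J z) = 3 ^ (card J - 1)"
      by (simp only: of_nat_eq_iff)
    then have "\<forall>y\<in>cube J z. cl y = 1 \<longrightarrow> y \<in> B"
      using B_full_iff[OF J] by blast
    then show ?thesis using that(2)[OF True] by blast
  next
    case False
    then obtain x where x: "x \<in> ?A" by blast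
    have full: "y \<in> A" if "y \<in> cube J z" "cl y = 0" for y
      using moves_connect[OF J(1) closed x] x that cl_A by force
    then have "card ?A = 3 ^ (card J - 1)" using A_full_iff[OF J] by blast
    then have "card (B \<inter> cube J z) = 0" using ex unfolding excess_def by simp
    then have "B \<inter> cube J z = {}" using fin by simp
    then show ?thesis using that(1) full by blast
  qed
qed


section \<open>Extending a full layer from a slice to the whole subcube\<close>

lemma perfectly_matched_dn:
  assumes "perfectly_matched J z" "J \<subseteq> D" "y \<in> B" "y \<in> cube J z" "i \<in> D" "i \<notin> J"
  shows "dn i y \<notin> A"
  using assms dn_unique unfolding perfectly_matched_def by blast

text \<open>Uniqueness as a forbidden path \<open>B\<close>, \<open>A\<close>, \<open>B\<close>.
  Used with \<open>intro\<close>, it empties a cell of \<open>B\<close> by asking only that two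
  nearby points lie in \<open>A\<close> and \<open>B\<close>.\<close>

lemma no_path_from_B:
  assumes "y \<in> B" "dn i y \<in> A" "up j (dn i y) \<in> B" "i \<in> D" "j \<in> D" "i \<noteq> j"
  shows False
  using assms up_unique[of "dn i y" i j] by simp

lemma no_path_from_A:
  assumes "x \<in> A" "up i x \<in> B" "dn j (up i x) \<in> A" "i \<in> D" "j \<in> D" "i \<noteq> j"
  shows False
  using assms dn_unique[of "up i x" i j] by simp

text \<open>Directions \<open>i\<close> and \<open>j\<close> cut the subcube into a 3 by 3 table of
  cells; \<open>k\<close> keeps their dimension positive. Forbidden paths and the bounds on rows,
  columns and cells fix the excesses up to one parameter.\<close>

lemma full_layer_exists_step:
  assumes J: "J \<subseteq> D" "i \<in> J" "j \<in> J" "i \<noteq> j" "k \<in> J" "k \<noteq> i" "k \<noteq> j"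
    and ex: "excess J z = 1"
    and le: "\<And>J' z'. J' \<subset> J \<Longrightarrow> J' \<noteq> {} \<Longrightarrow> excess J' z' \<le> 1"
    and matched: "\<And>J' z'. J' \<subset> J \<Longrightarrow> J' \<noteq> {} \<Longrightarrow> excess J' z' = 1 \<Longrightarrow> perfectly_matched J' z'"
    and slice: "excess (J - {i}) (z(i := c)) = 1"
    and full: "full_layer (J - {i}) (z(i := c)) j d"
  shows "\<exists>j\<in>J. \<exists>d. full_layer J z j d"
proof -
  let ?J = "J - {i, j}"
  define cell where "cell a b = cube ?J (z(i := a, j := b))" for a b
  define e where "e a b = excess ?J (z(i := a, j := b))" for a b
  define k0 where "k0 = (3::nat) ^ (card ?J - 1)"
  define K where "K = int k0"
  have K_eq: "K = 3 ^ (card ?J - 1)" unfolding K_def k0_def by simp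
  have K: "K \<ge> 1" unfolding K_eq by simp
  have D: "i \<in> D" "j \<in> D" "k \<in> D" using J by auto
  have J2: "?J \<subseteq> D" "?J \<noteq> {}" "?J \<subset> J" "i \<notin> ?J" "j \<notin> ?J" "k \<in> ?J" using J by auto
  have ne: "J - {i} \<noteq> {}" "J - {j} \<noteq> {}" using J by auto
  have Diff: "J - {i} - {j} = ?J" "J - {j} - {i} = ?J" by auto
  have twist: "z(j := b, i := a) = z(i := a, j := b)" for a b
    using J by (simp add: fun_upd_twist)
  have mem: "x \<in> cell a b \<longleftrightarrow> x \<in> cube J z \<and> x i = a \<and> x j = b" for x a b
    using slice_iff[of j "J - {i}" x "z(i := a)" b] slice_iff[of i J x z a] J Diff
    unfolding cell_def by auto
  have neq: "i \<noteq> j" "j \<noteq> i" "k \<noteq> i" "i \<noteq> k" "k \<noteq> j" "j \<noteq> k" using J by auto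
  note move = up_cube dn_cube cl_up cl_dn up_apply dn_apply cl_A cl_B J(2,3,5) D neq
  have A1: "x \<in> A" if "x \<in> cube J z" "cl x = 0" "x i = c" "x j = d" for x
    using full that J slice_iff[of i J x z c] unfolding full_layer_def by auto
  have B1: "y \<in> B" if "y \<in> cube J z" "cl y = 1" "y i = c" "y j = d + 1" for y
    using full that J slice_iff[of i J y z c] unfolding full_layer_def by auto

  have cardA: "int (card (A \<inter> cell a b)) = K \<longleftrightarrow> (\<forall>x\<in>cell a b. cl x = 0 \<longrightarrow> x \<in> A)" for a b
    using A_full_iff[OF J2(1,2)] unfolding cell_def K_def k0_def of_nat_eq_iff by blast
  have cardB: "int (card (B \<inter> cell a b)) = K \<longleftrightarrow> (\<forall>x\<in>cell a b. cl x = 1 \<longrightarrow> x \<in> B)" for a b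
    using B_full_iff[OF J2(1,2)] unfolding cell_def K_def k0_def of_nat_eq_iff by blast
  have e_eq: "e a b = int (card (A \<inter> cell a b)) + int (card (B \<inter> cell a b)) - K" for a b
    unfolding e_def cell_def K_eq excess_def ..
  have "int (card (A \<inter> cell a b)) \<le> K" "int (card (B \<inter> cell a b)) \<le> K" for a b
    using card_A_le[OF J2(1,2)] card_B_le[OF J2(1,2)]
    unfolding cell_def K_def k0_def of_nat_le_iff by blast+
  note card_le = this
  have e_le: "e a b \<le> 1" for a b
    unfolding e_def using le J2 by blast
  have e_matched: "e a b = 1 \<Longrightarrow> perfectly_matched ?J (z(i := a, j := b))" for a b
    unfolding e_def using matched J2 by blast

  \<comment> \<open>The given layer fills cell \<open>(c, d)\<close> by \<open>A\<close> and
    \<open>(c, d + 1)\<close> by \<open>B\<close>. In each of the next four claims, an extra point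
    would share a neighbour in this layer with another point of the layer.\<close>
  have B_cd: "B \<inter> cell c d = {}"
  proof -
    have False if "y \<in> B" "y \<in> cell c d" for y
      using that by (intro no_path_from_B[OF that(1), of k j] A1 B1) (auto simp: mem move)
    then show ?thesis by blast
  qed
  have A_cd1: "A \<inter> cell c (d + 1) = {}"
  proof -
    have False if "x \<in> A" "x \<in> cell c (d + 1)" for x
      using that by (intro no_path_from_A[OF that(1), of k j] A1 B1) (auto simp: mem move)
    then show ?thesis by blast
  qed
  have B_c1d: "B \<inter> cell (c + 1) d = {}"
  proof -
    have False if "y \<in> B" "y \<in> cell (c + 1) d" for y
      using that by (intro no_path_from_B[OF that(1), of i j] A1 B1) (auto simp: mem move)
    then show ?thesis by blast
  qed
  have A_c2d1: "A \<inter> cell (c + 2) (d + 1) = {}"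
  proof -
    have False if "x \<in> A" "x \<in> cell (c + 2) (d + 1)" for x
      using that by (intro no_path_from_A[OF that(1), of i j] A1 B1) (auto simp: mem move)
    then show ?thesis by blast
  qed
  have e00: "e c d = 0"
    using cardA[of c d] A1 B_cd unfolding e_eq by (simp add: mem)
  have e01: "e c (d + 1) = 0"
    using cardB[of c "d + 1"] B1 A_cd1 unfolding e_eq by (simp add: mem)
  have e10_le: "e (c + 1) d \<le> 0"
    using card_le[of "c + 1" d] B_c1d unfolding e_eq by simp
  have e21_le: "e (c + 2) (d + 1) \<le> 0"
    using card_le[of "c + 2" "d + 1"] A_c2d1 unfolding e_eq by simp

  have split_row: "excess (J - {i}) (z(i := a)) = e a d + e a (d + 1) + e a (d + 2)" for a
    using excess_split[of "J - {i}" j "z(i := a)" d] J J2 unfolding e_def Diff by auto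
  have split_col: "excess (J - {j}) (z(j := b)) = e c b + e (c + 1) b + e (c + 2) b" for b
    using excess_split[of "J - {j}" i "z(j := b)" c] J J2 unfolding e_def Diff twist by auto
  have row_le: "excess (J - {i}) (z(i := a)) \<le> 1" for a
    using J by (intro le) auto
  have col_le: "excess (J - {j}) (z(j := b)) \<le> 1" for b
    using J by (intro le) auto
  have row_unique: "excess (J - {i}) (z(i := a)) \<noteq> 1" if "a \<noteq> c" for a
    using no_two_excess_slices[of J i z a c] matched[of "J - {i}"] slice that J by blast
  \<comment> \<open>Here the slices of \<open>J - {j}\<close> in direction \<open>i\<close> are the
    cells of one column.\<close>
  have e_unique: "e a (d + 2) \<noteq> 1" if "e c (d + 2) = 1" "a \<noteq> c" for a
    using no_two_excess_slices[of "J - {j}" i "z(j := d + 2)" a c] e_matched J J2 that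
    unfolding e_def Diff twist by blast
  have rows: "excess (J - {i}) (z(i := c + 1)) = 0" "excess (J - {i}) (z(i := c + 2)) = 0"
    using excess_split[OF J(1,2) ne(1), of z c] row_le[of "c + 1"] row_le[of "c + 2"]
      row_unique[of "c + 1"] row_unique[of "c + 2"] slice ex by auto
  have cols: "excess (J - {j}) (z(j := d)) + excess (J - {j}) (z(j := d + 1))
      + excess (J - {j}) (z(j := d + 2)) = 1"
    using excess_split[OF J(1,3) ne(2), of z d] ex by auto
  have e02: "e c (d + 2) = 1"
    using split_row[of c] slice e00 e01 by simp
  have e12_le: "e (c + 1) (d + 2) \<le> 0" and e22_le: "e (c + 2) (d + 2) \<le> 0"
    using e_unique[OF e02, of "c + 1"] e_unique[OF e02, of "c + 2"]
      e_le[of "c + 1" "d + 2"] e_le[of "c + 2" "d + 2"] by auto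

  \<comment> \<open>The matched cell \<open>(c + 2, d)\<close> takes no partners from
    \<open>(c + 1, d)\<close>. Its \<open>B\<close> part has \<open>(K + 1) / 2\<close> points, so
    the \<open>A\<close> part of \<open>(c + 1, d)\<close> has at most \<open>(K - 1) / 2\<close>,
    and that cell has no \<open>B\<close>.\<close>
  have e20_1: "2 * e (c + 1) d \<le> - K - 1" if "e (c + 2) d = 1"
  proof -
    have "card (A \<inter> cell (c + 1) d) + card (B \<inter> cell (c + 1 + 1) d) \<le> 3 ^ (card ?J - 1)"
      unfolding cell_def twist[symmetric]
    proof (rule card_translate)
      fix x assume "x \<in> A" "x \<in> cube ?J (z(j := d, i := c + 1))"
      then have x: "x \<in> A" "x \<in> cell (c + 1) d" unfolding cell_def twist by auto
      show "up i x \<notin> B"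
      proof
        assume "up i x \<in> B"
        moreover have "up i x \<in> cube ?J (z(i := c + 2, j := d))"
          using x unfolding cell_def[symmetric] by (auto simp: mem move)
        ultimately have "dn i (up i x) \<notin> A"
          using perfectly_matched_dn e_matched[OF that] J2 D by blast
        then show False using x by simp
      qed
    qed (use J2 D in auto)
    then have "int (card (A \<inter> cell (c + 1) d)) + int (card (B \<inter> cell (c + 2) d)) \<le> K"
      unfolding K_def k0_def of_nat_add[symmetric] of_nat_le_iff by simp
    moreover have "2 * int (card (B \<inter> cell (c + 2) d)) = K + 1"
      using card_perfectly_matched(2)[OF e_matched[OF that]] that
      unfolding e_def cell_def K_eq by simp
    ultimately show ?thesis using B_c1d unfolding e_eq by simp
  qed
  \<comment> \<open>The mirror case: the lower cell is the matched one, and the \<open>B\<close>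
    part of the upper cell is bounded.\<close>
  have e11_1: "2 * e (c + 2) (d + 1) \<le> - K - 1" if "e (c + 1) (d + 1) = 1"
  proof -
    have "card (A \<inter> cell (c + 1) (d + 1)) + card (B \<inter> cell (c + 1 + 1) (d + 1)) \<le> 3 ^ (card ?J - 1)"
      unfolding cell_def twist[symmetric]
    proof (rule card_translate)
      fix x assume "x \<in> A" "x \<in> cube ?J (z(j := d + 1, i := c + 1))"
      then show "up i x \<notin> B"
        using perfectly_matched_up e_matched[OF that] J2 D unfolding twist by blast
    qed (use J2 D in auto)
    then have "int (card (A \<inter> cell (c + 1) (d + 1))) + int (card (B \<inter> cell (c + 2) (d + 1))) \<le> K"
      unfolding K_def k0_def of_nat_add[symmetric] of_nat_le_iff by simp
    moreover have "2 * int (card (A \<inter> cell (c + 1) (d + 1))) = K + 1"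
      using card_perfectly_matched(1)[OF e_matched[OF that]] that
      unfolding e_def cell_def K_eq by simp
    ultimately show ?thesis using A_c2d1 unfolding e_eq by simp
  qed

  have col0: "excess (J - {j}) (z(j := d)) \<noteq> 1"
  proof
    assume "excess (J - {j}) (z(j := d)) = 1"
    then show False
      using split_col[of d] e00 e10_le e_le[of "c + 2" d] e20_1 K by linarith
  qed
  have col1: "excess (J - {j}) (z(j := d + 1)) \<noteq> 1"
  proof
    assume "excess (J - {j}) (z(j := d + 1)) = 1"
    then show False
      using split_col[of "d + 1"] e01 e21_le e_le[of "c + 1" "d + 1"] e11_1 K by linarith
  qed
  \<comment> \<open>Columns \<open>d\<close> and \<open>d + 1\<close> contribute at most 0, so
    column \<open>d + 2\<close> contributes exactly 1, which cell \<open>(c, d + 2)\<close> already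
    supplies.\<close>
  have e_corner: "e (c + 1) (d + 2) = 0" "e (c + 2) (d + 2) = 0"
      "excess (J - {j}) (z(j := d)) = 0" "excess (J - {j}) (z(j := d + 1)) = 0"
    using cols col0 col1 col_le[of d] col_le[of "d + 1"] col_le[of "d + 2"]
      split_col[of "d + 2"] e02 e12_le e22_le by linarith+
  have e_rel: "e (c + 1) d = - e (c + 2) d" "e (c + 1) (d + 1) = e (c + 2) d"
      "e (c + 2) (d + 1) = - e (c + 2) d"
    using e_corner split_col[of d] split_col[of "d + 1"] e00 e01
      split_row[of "c + 1"] split_row[of "c + 2"] rows by linarith+
  \<comment> \<open>With \<open>\<delta> = e (c + 2) d\<close>, the table of \<open>e\<close> with rows \<open>c, c + 1, c + 2\<close> and columns
    \<open>d + 2, d, d + 1\<close> is now \<open>(1, 0, 0), (0, - \<delta>, \<delta>), (0, \<delta>, - \<delta>)\<close>. If \<open>\<delta> = 1\<close> then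
    \<open>K = 1\<close>, the subcube has dimension 3 and the full layer is in the third direction \<open>k\<close>.
    If \<open>\<delta> = 0\<close> then the cell \<open>(c + 2, d)\<close> contains no edge, hence is extremal: depending on
    whether it is filled by \<open>A\<close> or by \<open>B\<close>, the full layer is in direction \<open>j\<close> or \<open>i\<close>.\<close>
  have A_full: "x \<in> A" if "e a b = 0" "B \<inter> cell a b = {}" "x \<in> cell a b" "cl x = 0" for a b x
    using cardA[of a b] that unfolding e_eq by simp
  have B_full: "y \<in> B" if "e a b = 0" "A \<inter> cell a b = {}" "y \<in> cell a b" "cl y = 1" for a b y
    using cardB[of a b] that unfolding e_eq by simp
  have three: "a = b \<or> a = b + 1 \<or> a = b + 2" for a b :: 3
    using UNIV_Z3[of b] by blast
  show ?thesis
  proof (cases "e (c + 2) d = 1")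
    case True
    then have "K = 1" using e20_1 e_rel K by linarith
    then have "\<not> card ?J - 1 > 0"
      using one_less_power[of "3::int" "card ?J - 1"] unfolding K_eq by linarith
    moreover have "card ?J > 0"
      using J2(2) finite_subset[OF J2(1) finite_D] card_gt_0_iff by blast
    ultimately have "card ?J = 1" by linarith
    then have J_eq: "?J = {k}"
      using J2(6) by (metis card_1_singletonE singletonD)
    have both: "x \<in> cell a b \<Longrightarrow> (cl x = 0 \<longrightarrow> x \<in> A) \<and> (cl x = 1 \<longrightarrow> x \<in> B)"
      if "e a b = 1" for a b x
      using card_perfectly_matched[OF e_matched[OF that]] that cardA[of a b] cardB[of a b] \<open>K = 1\<close>
      unfolding e_def K_eq[symmetric] cell_def[symmetric] by auto
    \<comment> \<open>Equal level and equal coordinate \<open>k\<close> make the changes in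
      \<open>i\<close> and \<open>j\<close> cancel. So \<open>w\<close> lies in one of the cells
      \<open>(c, d + 2)\<close>, \<open>(c + 1, d + 1)\<close>, \<open>(c + 2, d)\<close>, all of
      excess 1.\<close>
    have locate: "e (w i) (w j) = 1"
      if v: "v \<in> cell c (d + 2)" and w: "w \<in> cube J z" "cl w = cl v" "w k = v k" for v w
    proof -
      have "w = v(i := v i + (w i - v i), j := v j + (w j - v j))"
      proof
        fix m
        have "m \<notin> J" if "m \<noteq> i" "m \<noteq> j" "m \<noteq> k" using J_eq that by blast
        then show "w m = (v(i := v i + (w i - v i), j := v j + (w j - v j))) m"
          using v w unfolding mem cube_def by (cases "m = k") auto
      qed
      then have "cl w = cl v + (w i - v i) + (w j - v j)"
        using cl_add[OF D(1), of v] cl_add[OF D(2), of "v(i := v i + (w i - v i))"] neq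
        by (metis fun_upd_other)
      then have "w j = d + 2 - (w i - c)"
        using v w unfolding mem by (simp add: algebra_simps)
      then show ?thesis
        using three[of "w i" c] e02 e_rel True by auto
    qed
    have "card (A \<inter> cell c (d + 2)) \<noteq> 0"
      using card_perfectly_matched(1)[OF e_matched[OF e02]] e02
      unfolding e_def K_eq[symmetric] cell_def[symmetric] \<open>K = 1\<close> by auto
    then obtain v where v: "v \<in> A" "v \<in> cell c (d + 2)"
      by (metis Int_iff card.empty ex_in_conv)
    have v': "up k v \<in> cell c (d + 2)" "cl (up k v) = 1" "up k v k = v k + 1"
      using v by (auto simp: mem move)
    have "full_layer J z k (v k)"
      unfolding full_layer_def
    proof (intro conjI ballI impI)
      fix x assume x: "x \<in> cube J z" "cl x = 0" "x k = v k"
      then have "e (x i) (x j) = 1" using v cl_A by (intro locate[OF v(2)]) auto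
      then show "x \<in> A" using both x by (simp add: mem)
    next
      fix y assume y: "y \<in> cube J z" "cl y = 1" "y k = v k + 1"
      then have "e (y i) (y j) = 1" using v' by (intro locate[OF v'(1)]) auto
      then show "y \<in> B" using both y by (simp add: mem)
    qed
    then show ?thesis using J by blast
  next
    case False
    then have e0: "e (c + 2) d = 0" "e (c + 1) d = 0" "e (c + 1) (d + 1) = 0" "e (c + 2) (d + 1) = 0"
      using e_le[of "c + 2" d] e_rel e10_le by linarith+
    have A10: "x \<in> A" if "x \<in> cube J z" "cl x = 0" "x i = c + 1" "x j = d" for x
      using A_full[OF e0(2) B_c1d] that mem by blast
    have B21: "y \<in> B" if "y \<in> cube J z" "cl y = 1" "y i = c + 2" "y j = d + 1" for y
      using B_full[OF e0(4) A_c2d1] that mem by blast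
    \<comment> \<open>By \<open>B21\<close> the only edge at \<open>x\<close> goes in direction
      \<open>j\<close>, out of the cell.\<close>
    have indep: "up m x \<notin> B" if "x \<in> A" "x \<in> cell (c + 2) d" "m \<in> ?J" for x m
    proof
      assume "up m x \<in> B"
      moreover have "up j x \<in> B" using that by (intro B21) (auto simp: mem move)
      ultimately show False using up_unique[of x m j] that J by auto
    qed
    have ex0: "excess ?J (z(i := c + 2, j := d)) = 0" using e0(1) unfolding e_def .
    show ?thesis
    proof (rule independent_extremal[OF J2(1,2) ex0 indep[unfolded cell_def]])
      assume A20: "\<And>x. x \<in> cube ?J (z(i := c + 2, j := d)) \<Longrightarrow> cl x = 0 \<Longrightarrow> x \<in> A"
      have A20: "x \<in> A" if "x \<in> cube J z" "cl x = 0" "x i = c + 2" "x j = d" for x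
        using A20 that unfolding cell_def[symmetric] mem by blast
      \<comment> \<open>Such an \<open>x\<close> would share the neighbour \<open>up i x\<close>
        with a point of \<open>A\<close> in cell \<open>(c + 2, d)\<close>. A cell of excess 0
        without \<open>A\<close> is filled by \<open>B\<close>.\<close>
      have "False" if "x \<in> A" "x \<in> cell (c + 1) (d + 1)" for x
        using that by (intro no_path_from_A[OF that(1), of i j] A20 B21) (auto simp: mem move)
      then have "A \<inter> cell (c + 1) (d + 1) = {}" by blast
      then have B11: "y \<in> B" if "y \<in> cube J z" "cl y = 1" "y i = c + 1" "y j = d + 1" for y
        using B_full[OF e0(3)] that mem by blast
      have "full_layer J z j d"
        unfolding full_layer_def
      proof (intro conjI ballI impI)
        fix x assume "x \<in> cube J z" "cl x = 0" "x j = d"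
        then show "x \<in> A" using three[of "x i" c] A1 A10 A20 by blast
      next
        fix y assume "y \<in> cube J z" "cl y = 1" "y j = d + 1"
        then show "y \<in> B" using three[of "y i" c] B1 B11 B21 by blast
      qed
      then show ?thesis using J by blast
    next
      assume B20: "\<And>x. x \<in> cube ?J (z(i := c + 2, j := d)) \<Longrightarrow> cl x = 1 \<Longrightarrow> x \<in> B"
      have B20: "y \<in> B" if "y \<in> cube J z" "cl y = 1" "y i = c + 2" "y j = d" for y
        using B20 that unfolding cell_def[symmetric] mem by blast
      \<comment> \<open>The same exclusion settles \<open>(c + 1, d + 1)\<close>, then from it
        \<open>(c + 1, d + 2)\<close>, and finally \<open>(c + 2, d + 2)\<close>: row
        \<open>c + 1\<close> is filled by \<open>A\<close> and row \<open>c + 2\<close> by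
        \<open>B\<close>.\<close>
      have "False" if "y \<in> B" "y \<in> cell (c + 1) (d + 1)" for y
        using that by (intro no_path_from_B[OF that(1), of j i] A10 B20) (auto simp: mem move)
      then have "B \<inter> cell (c + 1) (d + 1) = {}" by blast
      then have A11: "x \<in> A" if "x \<in> cube J z" "cl x = 0" "x i = c + 1" "x j = d + 1" for x
        using A_full[OF e0(3)] that mem by blast
      have "False" if "y \<in> B" "y \<in> cell (c + 1) (d + 2)" for y
        using that by (intro no_path_from_B[OF that(1), of j i] A11 B21) (auto simp: mem move)
      then have "B \<inter> cell (c + 1) (d + 2) = {}" by blast
      then have A12: "x \<in> A" if "x \<in> cube J z" "cl x = 0" "x i = c + 1" "x j = d + 2" for x
        using A_full[OF e_corner(1)] that mem by blast
      have "False" if "x \<in> A" "x \<in> cell (c + 2) (d + 2)" for x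
        using that by (intro no_path_from_A[OF that(1), of j i] A10 B20) (auto simp: mem move)
      then have "A \<inter> cell (c + 2) (d + 2) = {}" by blast
      then have B22: "y \<in> B" if "y \<in> cube J z" "cl y = 1" "y i = c + 2" "y j = d + 2" for y
        using B_full[OF e_corner(2)] that mem by blast
      have "full_layer J z i (c + 1)"
        unfolding full_layer_def Z3_add
      proof (intro conjI ballI impI)
        fix x assume "x \<in> cube J z" "cl x = 0" "x i = c + 1"
        then show "x \<in> A" using three[of "x j" d] A10 A11 A12 by blast
      next
        fix y assume "y \<in> cube J z" "cl y = 1" "y i = c + 2"
        then show "y \<in> B" using three[of "y j" d] B20 B21 B22 by blast
      qed
      then show ?thesis using J by blast
    qed
  qed
qed


section \<open>Induction on the dimension\<close>

text \<open>The claims need each other: bound and matching for smaller subcubes allow a full layer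
  of a slice to be extended, and the full layer yields the matching.\<close>

lemma excess_structure:
  assumes "J \<subseteq> D" "J \<noteq> {}"
  shows "excess J z \<le> 1 \<and>
    (excess J z = 1 \<longrightarrow> perfectly_matched J z \<and> (\<exists>j\<in>J. \<exists>d. full_layer J z j d))"
proof -
  have "finite J" using assms finite_D finite_subset by blast
  then show ?thesis using assms
  proof (induction J arbitrary: z rule: finite_psubset_induct)
    case (psubset J)
    have le: "excess J' z' \<le> 1" if "J' \<subset> J" "J' \<noteq> {}" for J' z'
      using psubset.IH[of J' z'] psubset.prems that by blast
    have matched: "perfectly_matched J' z'" if "J' \<subset> J" "J' \<noteq> {}" "excess J' z' = 1" for J' z'
      using psubset.IH[of J' z'] psubset.prems that by blast
    obtain i where i: "i \<in> J" using psubset.prems by blast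
    show ?case
    proof (cases "J - {i} = {}")
      case True
      then have J: "J = {i}" using i by blast
      have D: "i \<in> D" using i psubset.prems by blast
      \<comment> \<open>On a line of excess 1 the points of levels 0 and 1 are both present, so any
        \<open>d\<close> works.\<close>
      have "full_layer {i} z i d" if "excess {i} z = 1" for d
      proof -
        have "card (A \<inter> cube {i} z) \<le> 1" "card (B \<inter> cube {i} z) \<le> 1"
          using card_A_le[of "{i}" z] card_B_le[of "{i}" z] D by auto
        then have "card (A \<inter> cube {i} z) = 3 ^ (card {i} - 1)" "card (B \<inter> cube {i} z) = 3 ^ (card {i} - 1)"
          using that unfolding excess_def by auto
        then show ?thesis
          using A_full_iff[of "{i}" z] B_full_iff[of "{i}" z] D unfolding full_layer_def by blast
      qed
      then show ?thesis
        using excess_singleton_le[OF D] perfectly_matched_singleton[OF D] unfolding J by blast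
    next
      case False
      have sub: "J - {i} \<subset> J" using i by blast
      have split: "excess J z = excess (J - {i}) (z(i := a)) + excess (J - {i}) (z(i := a + 1))
          + excess (J - {i}) (z(i := a + 2))" for a
        using excess_split psubset.prems(1) i False by blast
      have slice_le: "excess (J - {i}) (z(i := a)) \<le> 1" for a
        using le[OF sub False] .
      have slice_unique: "a = b"
        if "excess (J - {i}) (z(i := a)) = 1" "excess (J - {i}) (z(i := b)) = 1" for a b
        using no_two_excess_slices[OF psubset.prems(1) i False matched[OF sub False] that] .
      \<comment> \<open>At most one of the three slices reaches 1; the others are at most 0.\<close>
      have bound: "excess J z \<le> 1"
        using split[of 0] slice_le[of 0] slice_le[of "0 + 1"] slice_le[of "0 + 2"]
          slice_unique[of 0 "0 + 1"] slice_unique[of 0 "0 + 2"] slice_unique[of "0 + 1" "0 + 2"]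
          Z3_distinct[of 0] by linarith
      have "perfectly_matched J z \<and> (\<exists>j\<in>J. \<exists>d. full_layer J z j d)" if ex: "excess J z = 1"
      proof -
        obtain c where c: "excess (J - {i}) (z(i := c)) = 1"
        proof (rule ccontr)
          assume "\<not> ?thesis"
          then have "excess (J - {i}) (z(i := a)) \<noteq> 1" for a using that by blast
          then have "excess (J - {i}) (z(i := a)) \<le> 0" for a using slice_le[of a] by (meson int_one_le_iff_zero_less linorder_not_less order_antisym)
          from this[of 0] this[of "0 + 1"] this[of "0 + 2"] show False
            using split[of 0] ex by linarith
        qed
        then obtain j d where j: "j \<in> J - {i}" "full_layer (J - {i}) (z(i := c)) j d"
          using psubset.IH[OF sub, of "z(i := c)"] psubset.prems False by blast
        have "\<exists>j\<in>J. \<exists>d. full_layer J z j d"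
        proof (cases "\<exists>k\<in>J. k \<noteq> i \<and> k \<noteq> j")
          case True
          then obtain k where "k \<in> J" "k \<noteq> i" "k \<noteq> j" by blast
          then show ?thesis
            using full_layer_exists_step[OF psubset.prems(1) i, of j k z c d] j ex le matched c
            by blast
        next
          case False
          then have J: "J - {i} = {j}" "J - {j} = {i}" using i j by blast+
          have D: "i \<in> D" "j \<in> D" using i j psubset.prems by blast+
          have pm: "perfectly_matched {j} (z(i := c))"
            using perfectly_matched_singleton[OF D(2)] c unfolding J by blast
          have "card (A \<inter> cube {j} (z(i := c))) \<noteq> 0"
            using card_perfectly_matched(1)[OF pm] c J by auto
          then have "A \<inter> cube {j} (z(i := c)) \<noteq> {}" by force
          then obtain x where x: "x \<in> A" "x \<in> cube {j} (z(i := c))" by blast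
          then have up_x: "up j x \<in> B"
            using pm unfolding perfectly_matched_def by blast
          have xJ: "x \<in> cube J z"
            using x slice_iff[OF i, of x z c] J by simp
          \<comment> \<open>In dimension 2 the level and coordinate \<open>j\<close> determine a
            point, so the matched pair \<open>x\<close>, \<open>up j x\<close> alone is a full
            layer.\<close>
          have eq: "w = v"
            if "w \<in> cube J z" "v \<in> cube J z" "cl w = cl v" "w j = v j" for w v
          proof (rule cube_determined[OF _ _ D(1) that(3)])
            show "w \<in> cube {i} (z(j := v j))" "v \<in> cube {i} (z(j := v j))"
              using that slice_iff[of j J _ z "v j"] j J by auto
          qed
          have "full_layer J z j (x j)"
            unfolding full_layer_def
          proof (intro conjI ballI impI)
            fix w assume "w \<in> cube J z" "cl w = 0" "w j = x j"
            then show "w \<in> A" using eq[of w x] xJ x(1) cl_A by simp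
          next
            fix w assume "w \<in> cube J z" "cl w = 1" "w j = x j + 1"
            then show "w \<in> B" using eq[of w "up j x"] xJ up_x cl_B j by (simp add: up_cube up_apply)
          qed
          then show ?thesis using j by blast
        qed
        then obtain k e where k: "k \<in> J" "full_layer J z k e" by blast
        then have "J - {k} \<noteq> {}" "J - {k} \<subset> J" using i j by blast+
        then have "perfectly_matched J z"
          using perfectly_matched_of_full_layer[OF psubset.prems(1) k(1) _ k(2) ex] matched by blast
        then show ?thesis using k by blast
      qed
      then show ?thesis using bound by blast
    qed
  qed
qed

lemma card_sparse_layers_le:
  assumes "D \<noteq> {}"
  shows "card (A \<inter> cube D z) + card (B \<inter> cube D z) \<le> 3 ^ (card D - 1) + 1"
proof -
  have "int (card (A \<inter> cube D z)) + int (card (B \<inter> cube D z)) \<le> int (3 ^ (card D - 1) + 1)"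
    using excess_structure[of D z] assms unfolding excess_def by simp
  then show ?thesis by linarith
qed

end

section \<open>Functions that are injective on lines\<close>

text \<open>All six permutations of the integers modulo 3 are affine. The slope is its own inverse,
  so a step by the slope raises the value by 1.\<close>

lemma inj_Z3_affine:
  fixes g :: "3 \<Rightarrow> 3"
  assumes "inj g"
  shows "g 1 - g 0 \<noteq> 0" "g a = g 0 + (g 1 - g 0) * a" "g (a + (g 1 - g 0)) = g a + 1"
proof -
  have d: "g 0 \<noteq> g 1" "g 0 \<noteq> g 2" "g 1 \<noteq> g 2"
    using assms by (auto simp: inj_eq)
  show "g 1 - g 0 \<noteq> 0" using d by simp
  have g2: "g 2 = g 0 + (g 1 - g 0) * 2" and "g 1 - g 0 = 1 \<or> g 1 - g 0 = 2"
    using d Z3_cases[of "g 0"] Z3_cases[of "g 1"] Z3_cases[of "g 2"] by auto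
  then show "g a = g 0 + (g 1 - g 0) * a" for a
    using d Z3_cases[of a] Z3_cases[of "g 0"] Z3_cases[of "g 1"] by auto
  from this[of "a + (g 1 - g 0)"] this[of a] show "g (a + (g 1 - g 0)) = g a + 1"
    using \<open>g 1 - g 0 = 1 \<or> g 1 - g 0 = 2\<close> by (auto simp: algebra_simps)
qed

text \<open>With different slopes, the linear equation \<open>g a = h a\<close> would have a
  solution.\<close>

lemma disjoint_Z3_affine:
  fixes g h :: "3 \<Rightarrow> 3"
  assumes "inj g" "inj h" "\<And>a. g a \<noteq> h a"
  shows "g 1 - g 0 = h 1 - h 0"
proof -
  define p q where "p = g 1 - g 0" and "q = h 1 - h 0"
  have "p \<noteq> 0" "q \<noteq> 0" unfolding p_def q_def using inj_Z3_affine(1) assms by blast+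
  moreover have "g 0 + p * a \<noteq> h 0 + q * a" for a
    using inj_Z3_affine(2)[of g a] inj_Z3_affine(2)[of h a] assms unfolding p_def q_def by metis
  from this[of 0] this[of 1] this[of 2] have "g 0 \<noteq> h 0" "g 0 + p \<noteq> h 0 + q" "g 0 + p * 2 \<noteq> h 0 + q * 2"
    by auto
  ultimately have "p = q"
    using Z3_cases[of "g 0"] Z3_cases[of "h 0"] Z3_cases[of p] Z3_cases[of q] by auto
  then show ?thesis unfolding p_def q_def .
qed

text \<open>Injectivity in direction \<open>k\<close> keeps \<open>F\<close> from agreeing at
  corresponding points of two lines that are parallel and differ in coordinate \<open>k\<close>. So
  the slope in direction \<open>i\<close> is constant, and it serves as
  \<open>\<epsilon> i\<close>.\<close>

lemma line_injective_affine:
  fixes F :: "('i \<Rightarrow> 3) \<Rightarrow> 3"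
  assumes "finite D"
    and inj: "\<And>x i. i \<in> D \<Longrightarrow> inj (\<lambda>a. F (x(i := a)))"
    and local: "\<And>x y. (\<And>i. i \<in> D \<Longrightarrow> x i = y i) \<Longrightarrow> F x = F y"
  obtains \<epsilon> where "\<And>i. i \<in> D \<Longrightarrow> \<epsilon> i \<noteq> 0"
    and "\<And>i x. i \<in> D \<Longrightarrow> F (x(i := x i + \<epsilon> i)) = F x + 1"
proof -
  define s where "s i x = F (x(i := 1)) - F (x(i := 0))" for i x
  have s_upd: "s i (x(k := b)) = s i x" if "i \<in> D" "k \<in> D" for i k x b
  proof (cases "k = i \<or> b = x k")
    case False
    have "F (x(k := b, i := a)) \<noteq> F (x(i := a))" for a
    proof -
      have "x(k := b, i := a) = x(i := a, k := b)" "x(i := a) = x(i := a, k := x k)"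
        using False by auto
      then show ?thesis
        using inj_eq[OF inj[OF that(2), of "x(i := a)"], of b "x k"] False by metis
    qed
    then show ?thesis
      unfolding s_def using disjoint_Z3_affine[OF inj[OF that(1)] inj[OF that(1)]] by blast
  qed (auto simp: s_def)
  have s_const: "s i x = s i y" if i: "i \<in> D" for i x y
  proof -
    \<comment> \<open>Coordinates of \<open>x\<close> are replaced by those of \<open>y\<close> one
      at a time; \<open>local\<close> then handles those outside \<open>D\<close>.\<close>
    have "E \<subseteq> D \<Longrightarrow> s i (\<lambda>k. if k \<in> E then y k else x k) = s i x" if "finite E" for E
      using that
    proof (induction E)
      case (insert k E)
      have "(\<lambda>m. if m \<in> insert k E then y m else x m) = (\<lambda>m. if m \<in> E then y m else x m)(k := y k)"
        by auto
      then show ?case using insert s_upd[OF i, of k] by auto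
    qed simp
    then have "s i x = s i (\<lambda>k. if k \<in> D then y k else x k)" using assms(1) by simp
    also have "\<dots> = s i y" unfolding s_def by (intro arg_cong2[of _ _ _ _ minus] local) auto
    finally show ?thesis .
  qed
  show ?thesis
  proof (rule that[of "\<lambda>i. s i (\<lambda>_. 0)"])
    fix i x assume i: "i \<in> D"
    show "s i (\<lambda>_. 0) \<noteq> 0"
      using inj_Z3_affine(1)[OF inj[OF i]] unfolding s_def by blast
    have "F (x(i := x i + s i x)) = F (x(i := x i)) + 1"
      using inj_Z3_affine(3)[OF inj[OF i], of x "x i"] unfolding s_def by simp
    then show "F (x(i := x i + s i (\<lambda>_. 0))) = F x + 1"
      using s_const[OF i, of x "\<lambda>_. 0"] by simp
  qed
qed

text \<open>\<open>G x\<close> is the coordinate \<open>k\<close> that puts \<open>x\<close> into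
  \<open>S\<close>, and \<open>F\<close> measures the distance to it. Equal values of
  \<open>F\<close> on a line in another direction give equal \<open>G\<close>, hence two points of
  \<open>S\<close> on one line. The shift by 2 leaves levels 0 and 1 for the complement of
  \<open>S\<close>.\<close>

lemma perfect_set_coloring:
  fixes S :: "('i \<Rightarrow> 3) set"
  assumes "finite D" "k \<in> D"
    and line: "\<And>x i. i \<in> D \<Longrightarrow> \<exists>!a. x(i := a) \<in> S"
    and local: "\<And>x y. (\<And>i. i \<in> D \<Longrightarrow> x i = y i) \<Longrightarrow> x \<in> S \<longleftrightarrow> y \<in> S"
  shows "\<exists>F \<epsilon>. (\<forall>x. x \<in> S \<longleftrightarrow> F x = (2::3)) \<and>
    (\<forall>i\<in>D. \<epsilon> i \<noteq> 0 \<and> (\<forall>x. F (x(i := x i + \<epsilon> i)) = F x + 1))"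
proof -
  define G where "G x = (THE a. x(k := a) \<in> S)" for x
  define F where "F x = x k - G x + 2" for x
  have G: "x(k := a) \<in> S \<longleftrightarrow> a = G x" for x a
    using theI'[OF line[OF assms(2)], of x] line[OF assms(2), of x] unfolding G_def by blast
  have F_S: "x \<in> S \<longleftrightarrow> F x = 2" for x
    using G[of x "x k"] unfolding F_def by simp
  have inj: "inj (\<lambda>a. F (x(i := a)))" if i: "i \<in> D" for x i
  proof (rule injI)
    fix a b assume eq: "F (x(i := a)) = F (x(i := b))"
    show "a = b"
    proof (cases "i = k")
      case True
      have "G (x(k := c)) = G x" for c unfolding G_def by simp
      then show ?thesis using eq True unfolding F_def by simp
    next
      case False
      then have "G (x(i := a)) = G (x(i := b))" using eq unfolding F_def by simp
      then have "x(i := a, k := G (x(i := a))) \<in> S" "x(i := b, k := G (x(i := a))) \<in> S"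
        using G by simp_all
      then have "x(k := G (x(i := a)), i := a) \<in> S" "x(k := G (x(i := a)), i := b) \<in> S"
        using False by (simp_all add: fun_upd_twist)
      then show ?thesis using line[OF i] by blast
    qed
  qed
  have "F x = F y" if "\<And>i. i \<in> D \<Longrightarrow> x i = y i" for x y
  proof -
    have "x(k := a) \<in> S \<longleftrightarrow> y(k := a) \<in> S" for a
      using that by (intro local) auto
    then show ?thesis using that assms(2) unfolding F_def G_def by simp
  qed
  from line_injective_affine[OF assms(1) inj this] show ?thesis
    using F_S by metis
qed

section \<open>Lines and maximum independent sets of the Hamming graph\<close>

lemma Z3_power_cube: "Z3_power n = cube {..<n} (\<lambda>_. undefined)"
  unfolding Z3_power_def cube_def by (auto simp: PiE_def extensional_def)

lemma Z3_power_upd: "x \<in> Z3_power n \<Longrightarrow> i < n \<Longrightarrow> x(i := a) \<in> Z3_power n"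
  unfolding Z3_power_cube cube_def by auto

lemma card_cube: "finite J \<Longrightarrow> card (cube J z) = 3 ^ card J"
proof (induction J arbitrary: z rule: finite_induct)
  case empty
  have "cube {} z = {z}" by (auto simp: cube_def)
  then show ?case by simp
next
  case (insert i J)
  then show ?case using card_cube_split[of "insert i J" i UNIV z 0] by simp
qed

lemma layered_cube_sum: "layered_cube {..<n::nat} (\<lambda>x. \<Sum>i<n. x i :: 3)"
proof
  fix i :: nat and x :: "nat \<Rightarrow> 3" assume i: "i \<in> {..<n}"
  have "(\<Sum>k<n. up i x k) = up i x i + (\<Sum>k\<in>{..<n} - {i}. up i x k)"
    using i by (intro sum.remove) auto
  also have "(\<Sum>k\<in>{..<n} - {i}. up i x k) = (\<Sum>k\<in>{..<n} - {i}. x k)"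
    by (intro sum.cong) (auto simp: up_apply)
  also have "up i x i + \<dots> = (x i + (\<Sum>k\<in>{..<n} - {i}. x k)) + 1"
    by (simp add: up_apply)
  also have "x i + (\<Sum>k\<in>{..<n} - {i}. x k) = (\<Sum>k<n. x k)"
    using i by (intro sum.remove[symmetric]) auto
  finally show "(\<Sum>k<n. up i x k) = (\<Sum>k<n. x k) + 1" .
qed simp

lemma adjacent_line:
  assumes "x \<in> Z3_power n" "i < n" "a \<noteq> b"
  shows "adjacent (hamming_graph n) (x(i := a)) (x(i := b))"
  unfolding adjacent_hamming_graph_iff using assms Z3_power_upd by auto

lemma adjacent_line_iff:
  "adjacent (hamming_graph n) x y \<longleftrightarrow>
     x \<in> Z3_power n \<and> (\<exists>i<n. \<exists>b. b \<noteq> x i \<and> y = x(i := b))"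
proof
  assume "adjacent (hamming_graph n) x y"
  then obtain i where i: "x \<in> Z3_power n" "y \<in> Z3_power n" "i < n" "x i \<noteq> y i"
      "\<And>k. k < n \<Longrightarrow> x k \<noteq> y k \<Longrightarrow> k = i"
    unfolding adjacent_hamming_graph_iff by blast
  have "y = x(i := y i)"
  proof
    fix k
    have "k \<ge> n \<Longrightarrow> x k = undefined" "k \<ge> n \<Longrightarrow> y k = undefined"
      using i(1,2) unfolding Z3_power_cube cube_def by auto
    then show "y k = (x(i := y i)) k"
      using i(5)[of k] by (metis fun_upd_apply not_le)
  qed
  then show "x \<in> Z3_power n \<and> (\<exists>i<n. \<exists>b. b \<noteq> x i \<and> y = x(i := b))"
    using i(1,3) i(4)[symmetric] by blast
next
  assume "x \<in> Z3_power n \<and> (\<exists>i<n. \<exists>b. b \<noteq> x i \<and> y = x(i := b))"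
  then obtain i b where "x \<in> Z3_power n" "i < n" "b \<noteq> x i" "y = x(i := b)" by blast
  then show "adjacent (hamming_graph n) x y"
    using adjacent_line[of x n i "x i" b] by simp
qed

text \<open>Level 0 of the coordinate sum is independent, so \<open>S\<close> has at least
  \<open>3 ^ (n - 1)\<close> points. Zeroing coordinate \<open>i\<close> is injective on the
  independent set \<open>S\<close>, so by counting it reaches every line in direction
  \<open>i\<close>.\<close>

lemma maximum_independent_set_line:
  assumes S: "maximum_independent_set (hamming_graph n) S" and x: "x \<in> Z3_power n" and i: "i < n"
  shows "\<exists>!a. x(i := a) \<in> S"
proof -
  interpret layered_cube "{..<n}" "\<lambda>x. \<Sum>i<n. x i" by (rule layered_cube_sum)
  let ?T = "{x. (\<Sum>i<n. x i) = 0} \<inter> cube {..<n} (\<lambda>_. undefined)"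
  have indep: "independent_set (hamming_graph n) S"
    and max: "\<And>T. independent_set (hamming_graph n) T \<Longrightarrow> card T \<le> card S"
    using S unfolding maximum_independent_set_def by auto
  have unique: "a = b" if "y \<in> Z3_power n" "k < n" "y(k := a) \<in> S" "y(k := b) \<in> S" for y k a b
    using that indep adjacent_line unfolding independent_set_def by metis
  have "independent_set (hamming_graph n) ?T"
    unfolding independent_set_def
  proof (intro conjI ballI)
    show "?T \<subseteq> verts (hamming_graph n)" by (auto simp: Z3_power_cube)
    fix u v assume uv: "u \<in> ?T" "v \<in> ?T"
    show "\<not> adjacent (hamming_graph n) u v"
    proof
      assume "adjacent (hamming_graph n) u v"
      then obtain k b where kb: "k < n" "b \<noteq> u k" "v = u(k := u k + (b - u k))"
        unfolding adjacent_line_iff by auto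
      then show False using uv cl_add[of k u "b - u k"] by auto
    qed
  qed
  then have "card S \<ge> card ?T" by (rule max)
  also have "card ?T = 3 ^ (n - 1)" using card_level[of "{..<n}"] i by auto
  finally have card_S: "3 ^ (n - 1) \<le> card S" .
  let ?P = "cube ({..<n} - {i}) ((\<lambda>_. undefined)(i := 0))"
  have S_sub: "S \<subseteq> Z3_power n" using indep unfolding independent_set_def by simp
  have P_iff: "y \<in> ?P \<longleftrightarrow> y \<in> Z3_power n \<and> y i = 0" for y
    using i unfolding Z3_power_cube by (intro slice_iff) auto
  have inj: "inj_on (\<lambda>y. y(i := 0)) S"
  proof (rule inj_onI)
    fix u v assume uv: "u \<in> S" "v \<in> S" "u(i := 0) = v(i := 0)"
    then have "v = u(i := v i)" by (metis fun_upd_triv fun_upd_upd)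
    moreover have "u = u(i := u i)" by simp
    ultimately have "u i = v i" using unique[of u i "u i" "v i"] uv S_sub i by auto
    with \<open>v = u(i := v i)\<close> show "u = v" by (metis fun_upd_triv)
  qed
  have "(\<lambda>y. y(i := 0)) ` S = ?P"
  proof (rule card_seteq)
    show "finite ?P" by (intro finite_cube) auto
    show "(\<lambda>y. y(i := 0)) ` S \<subseteq> ?P"
      using S_sub i Z3_power_upd unfolding P_iff[abs_def] subset_iff by (auto simp: P_iff)
    show "card ?P \<le> card ((\<lambda>y. y(i := 0)) ` S)"
      using card_S i by (simp add: card_image[OF inj] card_cube)
  qed
  moreover have "x(i := 0) \<in> ?P" using x i Z3_power_upd by (simp add: P_iff)
  ultimately obtain s where s: "s \<in> S" "x(i := 0) = s(i := 0)" by force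
  then have "x(i := s i) = s" by (metis fun_upd_triv fun_upd_upd)
  then show ?thesis using unique[OF x i] s by metis
qed

lemma unique_neighbour:
  assumes U: "finite U" "max_degree (induced_subgraph G U) \<le> 1"
    and "u \<in> U" "v \<in> U" "w \<in> U" "adjacent G u v" "adjacent G u w"
  shows "v = w"
proof -
  let ?H = "induced_subgraph G U"
  have verts: "verts ?H = U" unfolding induced_subgraph_def by simp
  have "degree ?H u \<le> max_degree ?H"
    unfolding max_degree_def verts using assms by (intro Max_ge) auto
  then have "card {w \<in> U. adjacent ?H u w} \<le> 1"
    using U(2) unfolding degree_def verts by simp
  moreover have "finite {w \<in> U. adjacent ?H u w}" using U by simp
  moreover have "adjacent ?H u v" "adjacent ?H u w"
    using assms unfolding adjacent_def induced_subgraph_def by auto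
  ultimately show ?thesis
    using assms by (auto simp: card_le_Suc0_iff_eq)
qed

section \<open>Transfer to the two sparse levels\<close>

lemma Z3_square: "(a::3) \<noteq> 0 \<Longrightarrow> a * a = 1"
  using Z3_cases[of a] by auto

theorem theorem1p3:
  fixes n :: nat and U :: "(nat \<Rightarrow> 3) set"
  assumes "n \<ge> 1"
    and "U \<subseteq> Z3_power n"
    and "\<exists>S. maximum_independent_set (hamming_graph n) S \<and> U \<inter> S = {}"
    and "max_degree (induced_subgraph (hamming_graph n) U) \<le> 1"
  shows "card U \<le> 3 ^ (n - 1) + 1"
proof -
  obtain S where S: "maximum_independent_set (hamming_graph n) S" "U \<inter> S = {}"
    using assms(3) by blast
  \<comment> \<open>The colouring lives on total functions, so \<open>S\<close> is pulled back along
    restriction.\<close>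
  define S' where "S' = {x. restrict x {..<n} \<in> S}"
  have restrict_Z: "restrict x {..<n} \<in> Z3_power n" for x :: "nat \<Rightarrow> 3"
    unfolding Z3_power_def by auto
  have line: "\<exists>!a. x(i := a) \<in> S'" if "i \<in> {..<n}" for x i
  proof -
    have "restrict (x(i := a)) {..<n} = (restrict x {..<n})(i := a)" for a
      using that by auto
    then show ?thesis
      using maximum_independent_set_line[OF S(1) restrict_Z, of i x] that
      unfolding S'_def by simp
  qed
  have local: "x \<in> S' \<longleftrightarrow> y \<in> S'" if "\<And>i. i \<in> {..<n} \<Longrightarrow> x i = y i" for x y
    using restrict_cong[of "{..<n}" "{..<n}" x y] that unfolding S'_def by (simp add: simp_implies_def)
  have zero: "0 \<in> {..<n}" using assms(1) by simp
  obtain F :: "(nat \<Rightarrow> 3) \<Rightarrow> 3" and \<epsilon>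
    where F: "\<forall>x. x \<in> S' \<longleftrightarrow> F x = 2"
      "\<forall>i\<in>{..<n}. \<epsilon> i \<noteq> 0 \<and> (\<forall>x. F (x(i := x i + \<epsilon> i)) = F x + 1)"
    using perfect_set_coloring[of "{..<n}" 0 S', OF finite_lessThan zero line local] by blast
  have F_S: "x \<in> S' \<longleftrightarrow> F x = 2" for x
    using F(1) by blast
  have \<epsilon>: "\<epsilon> i \<noteq> 0" "F (x(i := x i + \<epsilon> i)) = F x + 1" if "i < n" for i x
    using F(2) that by auto
  \<comment> \<open>The sign change turns unit steps into steps by \<open>\<epsilon> i\<close>,
    along which \<open>F\<close> grows by 1. Signs square to 1, so it is an involution.\<close>
  define \<sigma> where "\<sigma> x i = (if i < n then \<epsilon> i * x i else x i)" for x :: "nat \<Rightarrow> 3" and i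
  have \<sigma>_\<sigma>: "\<sigma> (\<sigma> x) = x" for x
    using \<epsilon>(1) Z3_square unfolding \<sigma>_def by (auto simp: fun_eq_iff mult.assoc[symmetric])
  have \<sigma>_up: "\<sigma> (up i x) = (\<sigma> x)(i := \<sigma> x i + \<epsilon> i)" if "i < n" for i x
    using that unfolding \<sigma>_def by (auto simp: fun_eq_iff up_apply algebra_simps)
  have \<sigma>_Z: "\<sigma> x \<in> Z3_power n \<longleftrightarrow> x \<in> Z3_power n" for x
    unfolding Z3_power_cube cube_def \<sigma>_def by auto
  define cl where "cl x = F (\<sigma> x)" for x
  define A B where "A = {x. \<sigma> x \<in> U \<and> cl x = 0}" and "B = {x. \<sigma> x \<in> U \<and> cl x = 1}"
  have finU: "finite U" using assms(2) finite_Z3_power finite_subset by blast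
  have adj: "adjacent (hamming_graph n) (\<sigma> x) (\<sigma> (up i x))"
      "adjacent (hamming_graph n) (\<sigma> (up i x)) (\<sigma> x)" if "\<sigma> x \<in> U" "i < n" for x i
  proof -
    have "\<sigma> x \<in> Z3_power n" using that assms(2) by blast
    from adjacent_line[OF this that(2), of "\<sigma> x i" "\<sigma> x i + \<epsilon> i"]
      adjacent_line[OF this that(2), of "\<sigma> x i + \<epsilon> i" "\<sigma> x i"]
    show "adjacent (hamming_graph n) (\<sigma> x) (\<sigma> (up i x))"
      "adjacent (hamming_graph n) (\<sigma> (up i x)) (\<sigma> x)"
      using \<epsilon>(1) that by (auto simp: \<sigma>_up)
  qed
  have \<sigma>_inj: "\<sigma> x = \<sigma> y \<Longrightarrow> x = y" for x y by (metis \<sigma>_\<sigma>)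
  interpret sparse_layers "{..<n}" cl A B
  proof
    show "cl (up i x) = cl x + 1" if "i \<in> {..<n}" for i x
      using that \<epsilon>(2) unfolding cl_def by (simp add: \<sigma>_up)
    show "cl x = 0" if "x \<in> A" for x using that unfolding A_def by simp
    show "cl y = 1" if "y \<in> B" for y using that unfolding B_def by simp
    show "i = j" if "x \<in> A" "i \<in> {..<n}" "j \<in> {..<n}" "up i x \<in> B" "up j x \<in> B" for x i j
    proof -
      have "\<sigma> (up i x) = \<sigma> (up j x)"
        using that adj unfolding A_def B_def
        by (intro unique_neighbour[OF finU assms(4), of "\<sigma> x"]) auto
      then have "up i x i = up j x i" using \<sigma>_inj by metis
      then show ?thesis by (auto simp: up_apply split: if_splits)
    qed
    show "i = j" if "y \<in> B" "i \<in> {..<n}" "j \<in> {..<n}" "dn i y \<in> A" "dn j y \<in> A" for y i j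
    proof -
      have "\<sigma> (dn i y) = \<sigma> (dn j y)"
        using that adj(2)[of "dn i y" i] adj(2)[of "dn j y" j] unfolding A_def B_def
        by (intro unique_neighbour[OF finU assms(4), of "\<sigma> y"]) auto
      then have "dn i y i = dn j y i" using \<sigma>_inj by metis
      then show ?thesis by (auto simp: dn_apply split: if_splits)
    qed
  qed simp
  \<comment> \<open>Level 2 corresponds to \<open>S\<close>, which \<open>U\<close> avoids.\<close>
  have cl_U: "cl x = 0 \<or> cl x = 1" if "\<sigma> x \<in> U" for x
  proof -
    have "restrict (\<sigma> x) {..<n} = \<sigma> x"
      using that assms(2) unfolding Z3_power_def by (metis PiE_restrict subsetD)
    then have "cl x \<noteq> 2"
      using S(2) that F_S[of "\<sigma> x"] unfolding cl_def S'_def by auto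
    then show ?thesis using Z3_cases[of "cl x"] by blast
  qed
  have sub: "\<sigma> x \<in> U \<Longrightarrow> x \<in> cube {..<n} (\<lambda>_. undefined)" for x
    using assms(2) \<sigma>_Z unfolding Z3_power_cube by blast
  have "U = \<sigma> ` (A \<inter> cube {..<n} (\<lambda>_. undefined) \<union> B \<inter> cube {..<n} (\<lambda>_. undefined))"
  proof (intro equalityI subsetI)
    fix u assume "u \<in> U"
    then have "\<sigma> (\<sigma> u) \<in> U" by (simp add: \<sigma>_\<sigma>)
    then have "\<sigma> u \<in> A \<inter> cube {..<n} (\<lambda>_. undefined) \<union> B \<inter> cube {..<n} (\<lambda>_. undefined)"
      using cl_U[of "\<sigma> u"] sub[of "\<sigma> u"] unfolding A_def B_def by blast
    then show "u \<in> \<sigma> ` (A \<inter> cube {..<n} (\<lambda>_. undefined) \<union> B \<inter> cube {..<n} (\<lambda>_. undefined))"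
      by (metis \<sigma>_\<sigma> imageI)
  qed (auto simp: A_def B_def)
  then have "card U \<le> card (A \<inter> cube {..<n} (\<lambda>_. undefined) \<union> B \<inter> cube {..<n} (\<lambda>_. undefined))"
    by (metis card_image_le finite_Int finite_UnI finite_cube finite_lessThan)
  also have "\<dots> \<le> card (A \<inter> cube {..<n} (\<lambda>_. undefined)) + card (B \<inter> cube {..<n} (\<lambda>_. undefined))"
    by (rule card_Un_le)
  also have "\<dots> \<le> 3 ^ (n - 1) + 1"
    using card_sparse_layers_le[of "\<lambda>_. undefined"] assms(1) by (auto simp: lessThan_empty_iff)
  finally show ?thesis .
qed

end
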